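(* Let $(X,\mu)$ be an irreducible discrete-time BRW with global survival, i.e. $\bar q(x)<1$ for all $x\in X$. Then there exist $x,y\in X$ with $q(x,y)\neq\bar q(x)$ (no strong local survival) if and only if there exist a finite nonempty set $A\subseteq X$ and $v\in[0,1]^X$ with $v\ge\bar q$ such that $G(v|x)\ge v(x)$ for all $x\in X\setminus A$, and $(\tau v)(x_0)>\max_{x\in A}(\tau v)(x)$ for some $x_0\in X\setminus A$, where $(\tau v)(x):=\frac{v(x)-\bar q(x)}{1-\bar q(x)}$.
   Context: $S_X:=\{f:X\to\mathbb N:\sum_yf(y)<\infty\}$, $X$ finite or countable. A discrete-time BRW $(X,\mu)$: probability measures $\mu_x$ on $S_X$; each particle at $x$ is independently replaced by $f(y)$ particles at each $y$, $f\sim\mu_x$. First moments $m_{xy}:=\sum_ff(y)\mu_x(f)$ with $\sup_x\sum_ym_{xy}<\infty$; irreducible means every $y$ is reachable from every $x$ via a path with $m_{x_ix_{i+1}}>0$. Generating function $G(z|x):=\sum_f\mu_x(f)\prod_yz(y)^{f(y)}$. Standing assumption: in every class of mutually reachable vertices there is a vertex at which a particle has, with positive probability, a number of children inside the class different from one. $q(x,y)$: probability starting from one particle at $x$ that eventually no particle is at $y$; $\bar q(x)$: probability of eventual total extinction. *)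

theory Defs
  imports "HOL-Probability.Probability"
begin

text \<open>Discrete-time branching random walk on a countable (or finite) type 'a.
  mu x is the offspring law of a particle at x: a distribution on configurations
  f :: 'a => nat (f y = number of children placed at y).\<close>

definition fin_supp :: "('a \<Rightarrow> nat) \<Rightarrow> bool" where
  "fin_supp f \<longleftrightarrow> finite {y. f y \<noteq> 0}"

text \<open>First moments m_xy.\<close>
definition brw_m :: "('a \<Rightarrow> ('a \<Rightarrow> nat) pmf) \<Rightarrow> 'a \<Rightarrow> 'a \<Rightarrow> ennreal" where
  "brw_m \<mu> x y = (\<integral>\<^sup>+ f. of_nat (f y) \<partial>measure_pmf (\<mu> x))"

definition brw_rel :: "('a \<Rightarrow> ('a \<Rightarrow> nat) pmf) \<Rightarrow> ('a \<times> 'a) set" where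
  "brw_rel \<mu> = {(a, b). brw_m \<mu> a b > 0}"

text \<open>Class of mutually reachable vertices containing x.\<close>
definition brw_class :: "('a \<Rightarrow> ('a \<Rightarrow> nat) pmf) \<Rightarrow> 'a \<Rightarrow> 'a set" where
  "brw_class \<mu> x = {y. (x, y) \<in> (brw_rel \<mu>)\<^sup>* \<and> (y, x) \<in> (brw_rel \<mu>)\<^sup>*}"

definition brw_irreducible :: "('a \<Rightarrow> ('a \<Rightarrow> nat) pmf) \<Rightarrow> bool" where
  "brw_irreducible \<mu> \<longleftrightarrow> (\<forall>x y. (x, y) \<in> (brw_rel \<mu>)\<^sup>*)"

text \<open>A BRW: offspring laws on finitely supported configurations, uniformly bounded
  first moments, and the standing (non-singularity) assumption.\<close>
definition BRW :: "('a \<Rightarrow> ('a \<Rightarrow> nat) pmf) \<Rightarrow> bool" where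
  "BRW \<mu> \<longleftrightarrow>
     (\<forall>x. \<forall>f\<in>set_pmf (\<mu> x). fin_supp f) \<and>
     (SUP x. \<integral>\<^sup>+ y. brw_m \<mu> x y \<partial>count_space UNIV) < \<infinity> \<and>
     (\<forall>x. \<exists>w\<in>brw_class \<mu> x.
        measure_pmf.prob (\<mu> w) {f. sum f {y \<in> brw_class \<mu> x. f y \<noteq> 0} \<noteq> 1} > 0)"

text \<open>Generating function G(z|x).\<close>
definition brw_G :: "('a \<Rightarrow> ('a \<Rightarrow> nat) pmf) \<Rightarrow> ('a \<Rightarrow> real) \<Rightarrow> 'a \<Rightarrow> real" where
  "brw_G \<mu> z x = measure_pmf.expectation (\<mu> x) (\<lambda>f. \<Prod>y\<in>{y. f y \<noteq> 0}. z y ^ f y)"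

text \<open>Construction of the process (Ulam-Harris labelling). A particle is labelled by
  its ancestry u, a list of steps (y,k) = "the k-th child placed at y". Position of u
  when the ancestor sits at x: x if u = [], else the vertex of its last step.
  omega u is the offspring configuration of particle u, drawn independently from
  mu (pos u). Particle u exists iff each step (y,k) at index i has k < omega (take i u) y.
  Generation of u is length u.\<close>
definition brw_pos :: "'a \<Rightarrow> ('a \<times> nat) list \<Rightarrow> 'a" where
  "brw_pos x u = (if u = [] then x else fst (last u))"

definition brw_alive :: "(('a \<times> nat) list \<Rightarrow> 'a \<Rightarrow> nat) \<Rightarrow> ('a \<times> nat) list \<Rightarrow> bool" where
  "brw_alive \<omega> u \<longleftrightarrow> (\<forall>i<length u. snd (u ! i) < \<omega> (take i u) (fst (u ! i)))"

definition brw_space :: "('a \<Rightarrow> ('a \<Rightarrow> nat) pmf) \<Rightarrow> 'a \<Rightarrow> (('a \<times> nat) list \<Rightarrow> 'a \<Rightarrow> nat) measure" where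
  "brw_space \<mu> x = (\<Pi>\<^sub>M u\<in>UNIV. measure_pmf (\<mu> (brw_pos x u)))"

text \<open>q(x,y): probability, starting from one particle at x, that eventually no particle is at y.\<close>
definition brw_q :: "('a \<Rightarrow> ('a \<Rightarrow> nat) pmf) \<Rightarrow> 'a \<Rightarrow> 'a \<Rightarrow> real" where
  "brw_q \<mu> x y = measure (brw_space \<mu> x)
     {\<omega> \<in> space (brw_space \<mu> x). \<exists>n. \<forall>u. brw_alive \<omega> u \<and> n \<le> length u \<longrightarrow> brw_pos x u \<noteq> y}"

text \<open>bar q(x): probability of eventual global extinction.\<close>
definition brw_qbar :: "('a \<Rightarrow> ('a \<Rightarrow> nat) pmf) \<Rightarrow> 'a \<Rightarrow> real" where
  "brw_qbar \<mu> x = measure (brw_space \<mu> x)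
     {\<omega> \<in> space (brw_space \<mu> x). \<exists>n. \<forall>u. length u = n \<longrightarrow> \<not> brw_alive \<omega> u}"

definition brw_tau :: "('a \<Rightarrow> ('a \<Rightarrow> nat) pmf) \<Rightarrow> ('a \<Rightarrow> real) \<Rightarrow> 'a \<Rightarrow> real" where
  "brw_tau \<mu> v x = (v x - brw_qbar \<mu> x) / (1 - brw_qbar \<mu> x)"

end

theory Submission
  imports Defs
begin

text \<open>
  If \<open>q(x,y) \<noteq> qbar(x)\<close>, take \<open>A = {y}\<close> and let \<open>v(z)\<close> be the probability, starting from \<open>z\<close>, of never
  visiting \<open>y\<close> or dying out. Then \<open>v = qbar\<close> on \<open>A\<close> and \<open>v \<le> G(v)\<close> off \<open>A\<close>. If \<open>v = qbar\<close> held everywhere,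
  then after the last visit to \<open>y\<close> each of the finitely many living particles would have an extinct
  progeny, so \<open>q(\<cdot>,y) = qbar\<close>.

  Conversely let \<open>q = qbar\<close> and let \<open>t\<close> be the maximum of \<open>\<tau> v\<close> on \<open>A\<close>, so that \<open>v \<le> (1 - t) qbar + t\<close>
  on \<open>A\<close>. Since \<open>G((1 - t) z + t) \<le> (1 - t) G(z) + t\<close>, iterating \<open>v \<le> G(v)\<close> off \<open>A\<close> gives
  \<open>v \<le> (1 - t) d + t\<close>, where \<open>d\<close> is the probability that every particle hitting \<open>A\<close> has an extinct
  progeny. Pick \<open>c < 1\<close> with \<open>qbar \<le> c\<close> on \<open>A\<close>. The product of \<open>1[extinct] / c\<close> over the first hits
  of \<open>A\<close> has expectation at most 1, so by Fatou the event of \<open>d\<close> almost surely allows only finitely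
  many first hits, hence finitely many visits to \<open>A\<close>. Therefore \<open>d \<le> q(\<cdot>,y) = qbar\<close> for \<open>y \<in> A\<close>, that is
  \<open>\<tau> v \<le> t\<close> everywhere.
\<close>

definition offspring :: "('a \<Rightarrow> nat) \<Rightarrow> ('a \<times> nat) set" where
  "offspring f = {p. snd p < f (fst p)}"

definition extinct :: "(('a \<times> nat) list \<Rightarrow> 'a \<Rightarrow> nat) \<Rightarrow> bool" where
  "extinct \<omega> \<longleftrightarrow> (\<exists>n. \<forall>u. length u = n \<longrightarrow> \<not> brw_alive \<omega> u)"

lemma offspring_Sigma:
  "offspring f = (SIGMA y:{y. f y \<noteq> 0}. {..<f y})"
  by (auto simp: offspring_def)

lemma finite_offspring_iff: "finite (offspring f) \<longleftrightarrow> fin_supp f"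
proof
  assume "finite (offspring f)"
  moreover have "{y. f y \<noteq> 0} \<subseteq> fst ` offspring f"
    by (force simp: offspring_def image_iff)
  ultimately show "fin_supp f"
    unfolding fin_supp_def by (blast intro: finite_subset)
qed (auto simp: offspring_Sigma fin_supp_def)

lemma prod_offspring:
  fixes z :: "'a \<Rightarrow> 'b::comm_monoid_mult"
  assumes "fin_supp f"
  shows "(\<Prod>p\<in>offspring f. z (fst p)) = (\<Prod>y\<in>{y. f y \<noteq> 0}. z y ^ f y)"
proof -
  have "(\<Prod>p\<in>offspring f. z (fst p)) = (\<Prod>y\<in>{y. f y \<noteq> 0}. \<Prod>k<f y. z y)"
    using assms unfolding offspring_Sigma fin_supp_def
    by (subst prod.Sigma) (auto simp: split_def)
  then show ?thesis by simp
qed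

lemma countable_fin_supp: "countable {f :: 'a::countable \<Rightarrow> nat. fin_supp f}"
proof -
  have inj: "inj (offspring :: ('a \<Rightarrow> nat) \<Rightarrow> _)"
  proof (rule injI)
    fix f g :: "'a \<Rightarrow> nat" assume eq: "offspring f = offspring g"
    have "{..<f y} = {..<g y}" for y
      using eq by (auto simp: offspring_def set_eq_iff)
    then show "f = g" by (auto simp: fun_eq_iff)
  qed
  have "countable {S :: ('a \<times> nat) set. finite S}"
    using countable_Collect_finite by simp
  moreover have "offspring ` {f :: 'a \<Rightarrow> nat. fin_supp f} \<subseteq> {S. finite S}"
    by (auto simp: finite_offspring_iff)
  ultimately have "countable (offspring ` {f :: 'a \<Rightarrow> nat. fin_supp f})"
    by (rule countable_subset[rotated])
  then show ?thesis
    by (rule countable_image_inj_on) (rule inj_on_subset[OF inj subset_UNIV])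
qed

lemma alive_Nil [simp]: "brw_alive \<omega> []"
  by (simp add: brw_alive_def)

lemma alive_append:
  "brw_alive \<omega> (u @ v) \<longleftrightarrow> brw_alive \<omega> u \<and> brw_alive (\<lambda>w. \<omega> (u @ w)) v"
proof -
  have "(\<forall>i<length u + length v. P i) \<longleftrightarrow> (\<forall>i<length u. P i) \<and> (\<forall>i<length v. P (length u + i))"
    for P :: "nat \<Rightarrow> bool"
  proof safe
    fix i assume *: "\<forall>i<length u. P i" "\<forall>i<length v. P (length u + i)" "i < length u + length v"
    show "P i"
    proof (cases "i < length u")
      case False
      then show ?thesis using *(2)[rule_format, of "i - length u"] *(3) by simp
    qed (use * in simp)
  qed auto
  then show ?thesis
    by (auto simp: brw_alive_def nth_append)
qed

lemma alive_Cons: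
  "brw_alive \<omega> (p # v) \<longleftrightarrow> p \<in> offspring (\<omega> []) \<and> brw_alive (\<lambda>w. \<omega> (p # w)) v"
  using alive_append[of \<omega> "[p]" v] by (simp add: brw_alive_def offspring_def)

lemma pos_Nil [simp]: "brw_pos x [] = x"
  by (simp add: brw_pos_def)

lemma pos_append: "brw_pos x (u @ v) = brw_pos (brw_pos x u) v"
  by (simp add: brw_pos_def)

lemma pos_Cons: "brw_pos x (p # v) = brw_pos (fst p) v"
  by (simp add: brw_pos_def)

lemma space_brw_space [simp]: "space (brw_space \<mu> x) = UNIV"
  by (simp add: brw_space_def space_PiM)

lemma sets_brw_space:
  "sets (brw_space \<mu> x) = sets (\<Pi>\<^sub>M u\<in>UNIV. count_space UNIV)"
  unfolding brw_space_def by (intro sets_PiM_cong) auto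

lemma prob_space_brw_space: "prob_space (brw_space \<mu> x)"
  unfolding brw_space_def by (intro prob_space_PiM prob_space_measure_pmf)

lemma measurable_coordinate [measurable]:
  "(\<lambda>\<omega>. \<omega> u) \<in> measurable (brw_space \<mu> x) (count_space UNIV)"
proof -
  have "(\<lambda>\<omega>. \<omega> u) \<in> measurable (\<Pi>\<^sub>M u\<in>UNIV. count_space UNIV) (count_space UNIV)"
    by (rule measurable_component_singleton) simp
  then show ?thesis
    by (subst measurable_cong_sets[OF sets_brw_space refl])
qed

lemma measurable_subtree [measurable]:
  "(\<lambda>\<omega> v. \<omega> (u @ v)) \<in> measurable (brw_space \<mu> x) (brw_space \<mu> y)" (is ?thesis1)
  "(\<lambda>\<omega> v. \<omega> (p # v)) \<in> measurable (brw_space \<mu> x) (brw_space \<mu> y)" (is ?thesis2)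
proof -
  have "(\<lambda>\<omega> v. \<omega> (h v)) \<in> measurable (brw_space \<mu> x) (brw_space \<mu> y)" for h
    unfolding brw_space_def[of \<mu> y]
    by (rule measurable_PiM_single') (auto intro: measurable_coordinate)
  from this[of "(@) u"] this[of "(#) p"] show "?thesis1" "?thesis2" by simp_all
qed

lemma measurable_alive [measurable]: "Measurable.pred (brw_space \<mu> x) (\<lambda>\<omega>. brw_alive \<omega> u)"
proof -
  have "Measurable.pred (brw_space \<mu> x) (\<lambda>\<omega>. k < \<omega> u y)" for k u y
    by (rule measurable_compose[OF measurable_coordinate]) simp
  then show ?thesis
    unfolding brw_alive_def by (intro pred_intros_countable pred_intros_logic) simp_all
qed

lemma measurable_extinct [measurable]:
  "Measurable.pred (brw_space (\<mu> :: 'a::countable \<Rightarrow> _) x) extinct"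
  unfolding extinct_def[abs_def]
  by (intro pred_intros_countable pred_intros_logic measurable_alive) simp_all

lemma distr_coordinate: "distr (brw_space \<mu> x) (count_space UNIV) (\<lambda>\<omega>. \<omega> u) = \<mu> (brw_pos x u)"
proof -
  have "distr (brw_space \<mu> x) (\<mu> (brw_pos x u)) (\<lambda>\<omega>. \<omega> u) = \<mu> (brw_pos x u)"
    unfolding brw_space_def
    by (rule distr_PiM_component) (auto intro: prob_space_measure_pmf)
  moreover have "distr (brw_space \<mu> x) (count_space UNIV) (\<lambda>\<omega>. \<omega> u) =
      distr (brw_space \<mu> x) (\<mu> (brw_pos x u)) (\<lambda>\<omega>. \<omega> u)"
    by (rule distr_cong) simp_all
  ultimately show ?thesis by simp
qed

lemma distr_subtree:
  "distr (brw_space \<mu> x) (brw_space \<mu> (brw_pos x u)) (\<lambda>\<omega> v. \<omega> (u @ v)) = brw_space \<mu> (brw_pos x u)"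
  using distr_PiM_reindex[of UNIV "\<lambda>v. measure_pmf (\<mu> (brw_pos x v))" "\<lambda>v. u @ v" UNIV]
  by (simp add: brw_space_def pos_append prob_space_measure_pmf inj_on_def restrict_UNIV)

lemma indep_coordinates:
  "prob_space.indep_vars (brw_space \<mu> x) (\<lambda>u. measure_pmf (\<mu> (brw_pos x u))) (\<lambda>u \<omega>. \<omega> u) UNIV"
proof -
  interpret prob_space "brw_space \<mu> x" by (rule prob_space_brw_space)
  have comp: "distr (brw_space \<mu> x) (measure_pmf (\<mu> (brw_pos x u))) (\<lambda>\<omega>. \<omega> u) = \<mu> (brw_pos x u)" for u
    unfolding brw_space_def
    by (rule distr_PiM_component) (auto intro: prob_space_measure_pmf)
  have "distr (brw_space \<mu> x) (\<Pi>\<^sub>M u\<in>UNIV. measure_pmf (\<mu> (brw_pos x u))) (\<lambda>\<omega>. \<lambda>u\<in>UNIV. \<omega> u) = brw_space \<mu> x"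
    by (simp add: restrict_UNIV brw_space_def[symmetric] distr_id)
  then show ?thesis
    by (subst indep_vars_iff_distr_eq_PiM') (simp_all only: comp brw_space_def[symmetric] UNIV_not_empty
       not_False_eq_True measurable_pmf_measure2 measurable_coordinate)
qed

lemma nn_integral_branching_given_root:
  assumes f: "fin_supp f"
    and F [measurable]: "\<And>y. F y \<in> borel_measurable (brw_space \<mu> y)"
  shows "(\<integral>\<^sup>+\<omega>. (\<Prod>p\<in>offspring f. F (fst p) (\<lambda>v. \<omega> (p # v))) * indicator {\<omega> []} f \<partial>brw_space \<mu> x) =
    ennreal (pmf (\<mu> x) f) * (\<Prod>p\<in>offspring f. \<integral>\<^sup>+\<omega>. F (fst p) \<omega> \<partial>brw_space \<mu> (fst p))"
proof -
  interpret prob_space "brw_space \<mu> x" by (rule prob_space_brw_space)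
  define L :: "('a \<times> nat) option \<Rightarrow> ('a \<times> nat) list set"
    where "L = case_option {[]} (\<lambda>p. range (Cons p))"
  define M where "M u = measure_pmf (\<mu> (brw_pos x u))" for u
  define Y :: "('a \<times> nat) option \<Rightarrow> (('a \<times> nat) list \<Rightarrow> 'a \<Rightarrow> nat) \<Rightarrow> ennreal"
    where "Y = case_option (\<lambda>r. indicator {r []} f) (\<lambda>p r. F (fst p) (\<lambda>v. r (p # v)))"
  define I where "I = insert None (Some ` offspring f)"
  have fin: "finite (offspring f)"
    using f by (simp add: finite_offspring_iff)
  have "disjoint_family_on L I"
    by (auto simp: disjoint_family_on_def L_def split: option.splits)
  then have "indep_vars (\<lambda>i. PiM (L i) M) (\<lambda>i \<omega>. \<lambda>u\<in>L i. \<omega> u) I"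
    using indep_vars_restrict[OF indep_coordinates, of I L] by (simp add: M_def[abs_def])
  moreover have "Y i \<in> borel_measurable (PiM (L i) M)" for i
  proof (cases i)
    case None
    have "(\<lambda>r. r []) \<in> measurable (PiM {[]} M) (M [])"
      by (rule measurable_component_singleton) simp
    then have "(\<lambda>r. indicator {r []} f :: ennreal) \<in> borel_measurable (PiM {[]} M)"
      by (rule measurable_compose) (simp add: M_def)
    then show ?thesis using None by (simp add: Y_def L_def)
  next
    case (Some p)
    have "(\<lambda>r v. r (p # v)) \<in> measurable (PiM (range (Cons p)) M) (brw_space \<mu> (fst p))"
      unfolding brw_space_def
    proof (rule measurable_PiM_single')
      fix v
      have "(\<lambda>r. r (p # v)) \<in> measurable (PiM (range (Cons p)) M) (M (p # v))"
        by (rule measurable_component_singleton) simp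
      then show "(\<lambda>r. r (p # v)) \<in> measurable (PiM (range (Cons p)) M) (measure_pmf (\<mu> (brw_pos (fst p) v)))"
        by (simp only: M_def pos_Cons)
    qed simp
    then have "(\<lambda>r. F (fst p) (\<lambda>v. r (p # v))) \<in> borel_measurable (PiM (range (Cons p)) M)"
      by (rule measurable_compose) (rule F)
    then show ?thesis using Some by (simp add: Y_def L_def)
  qed
  ultimately have ind: "indep_vars (\<lambda>_. borel) (\<lambda>i \<omega>. Y i (\<lambda>u\<in>L i. \<omega> u)) I"
    by (rule indep_vars_compose2)
  have Y_None: "Y None (\<lambda>u\<in>L None. \<omega> u) = indicator {\<omega> []} f" for \<omega>
    by (simp add: Y_def L_def)
  have Y_Some: "Y (Some p) (\<lambda>u\<in>L (Some p). \<omega> u) = F (fst p) (\<lambda>v. \<omega> (p # v))" for \<omega> p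
    by (simp add: Y_def L_def)
  have prod_I: "(\<Prod>i\<in>I. h i) = h None * (\<Prod>p\<in>offspring f. h (Some p))" for h :: "_ \<Rightarrow> ennreal"
    using fin by (simp add: I_def prod.reindex)
  have root: "(\<integral>\<^sup>+\<omega>. indicator {\<omega> []} f \<partial>brw_space \<mu> x) = ennreal (pmf (\<mu> x) f)"
  proof -
    have "(\<integral>\<^sup>+\<omega>. indicator {\<omega> []} f \<partial>brw_space \<mu> x) =
        (\<integral>\<^sup>+g. indicator {g} f \<partial>distr (brw_space \<mu> x) (count_space UNIV) (\<lambda>\<omega>. \<omega> []))"
      by (subst nn_integral_distr) simp_all
    also have "\<dots> = (\<integral>\<^sup>+g. indicator {f} g \<partial>measure_pmf (\<mu> x))"
      by (simp only: distr_coordinate pos_Nil) (intro nn_integral_cong, simp add: indicator_def eq_commute)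
    finally show ?thesis
      by (simp add: emeasure_pmf_single)
  qed
  have child: "(\<integral>\<^sup>+\<omega>. F (fst p) (\<lambda>v. \<omega> (p # v)) \<partial>brw_space \<mu> x) = (\<integral>\<^sup>+\<omega>. F (fst p) \<omega> \<partial>brw_space \<mu> (fst p))" for p
  proof -
    have "(\<integral>\<^sup>+\<omega>. F (fst p) (\<lambda>v. \<omega> (p # v)) \<partial>brw_space \<mu> x) =
        (\<integral>\<^sup>+\<omega>. F (fst p) \<omega> \<partial>distr (brw_space \<mu> x) (brw_space \<mu> (fst p)) (\<lambda>\<omega> v. \<omega> (p # v)))"
      by (rule nn_integral_distr[symmetric]) (use F[of "fst p"] in \<open>auto intro: measurable_subtree\<close>)
    moreover have "distr (brw_space \<mu> x) (brw_space \<mu> (fst p)) (\<lambda>\<omega> v. \<omega> (p # v)) = brw_space \<mu> (fst p)"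
      using distr_subtree[of \<mu> x "[p]"] by (simp add: brw_pos_def)
    ultimately show ?thesis by simp
  qed
  have "(\<integral>\<^sup>+\<omega>. (\<Prod>p\<in>offspring f. F (fst p) (\<lambda>v. \<omega> (p # v))) * indicator {\<omega> []} f \<partial>brw_space \<mu> x) =
      (\<integral>\<^sup>+\<omega>. (\<Prod>i\<in>I. Y i (\<lambda>u\<in>L i. \<omega> u)) \<partial>brw_space \<mu> x)"
    by (simp only: prod_I Y_None Y_Some mult.commute)
  also have "\<dots> = (\<Prod>i\<in>I. \<integral>\<^sup>+\<omega>. Y i (\<lambda>u\<in>L i. \<omega> u) \<partial>brw_space \<mu> x)"
    using fin by (intro indep_vars_nn_integral ind) (auto simp: I_def)
  also have "\<dots> = ennreal (pmf (\<mu> x) f) * (\<Prod>p\<in>offspring f. \<integral>\<^sup>+\<omega>. F (fst p) \<omega> \<partial>brw_space \<mu> (fst p))"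
    by (simp only: prod_I Y_None Y_Some root child)
  finally show ?thesis .
qed

lemma AE_coordinate_set_pmf: "AE \<omega> in brw_space \<mu> x. \<omega> u \<in> set_pmf (\<mu> (brw_pos x u))"
proof -
  have "AE f in distr (brw_space \<mu> x) (count_space UNIV) (\<lambda>\<omega>. \<omega> u). f \<in> set_pmf (\<mu> (brw_pos x u))"
    unfolding distr_coordinate by (rule AE_measure_pmf)
  then show ?thesis
    by (rule AE_distrD[OF measurable_coordinate])
qed

lemma nn_integral_branching:
  assumes fin: "\<forall>f\<in>set_pmf (\<mu> x). fin_supp f"
    and F [measurable]: "\<And>y. F y \<in> borel_measurable (brw_space \<mu> y)"
  shows "(\<integral>\<^sup>+\<omega>. (\<Prod>p\<in>offspring (\<omega> []). F (fst p) (\<lambda>v. \<omega> (p # v))) \<partial>brw_space \<mu> x) =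
    (\<integral>\<^sup>+f. (\<Prod>p\<in>offspring f. \<integral>\<^sup>+\<omega>. F (fst p) \<omega> \<partial>brw_space \<mu> (fst p)) \<partial>\<mu> x)"
proof -
  let ?S = "set_pmf (\<mu> x)"
  let ?h = "\<lambda>f \<omega>. (\<Prod>p\<in>offspring f. F (fst p) (\<lambda>v. \<omega> (p # v)))"
  let ?k = "\<lambda>f. (\<Prod>p\<in>offspring f. \<integral>\<^sup>+\<omega>. F (fst p) \<omega> \<partial>brw_space \<mu> (fst p))"
  have "AE \<omega> in brw_space \<mu> x. \<omega> [] \<in> ?S"
    using AE_coordinate_set_pmf[where u = "[]"] by simp
  then have "(\<integral>\<^sup>+\<omega>. ?h (\<omega> []) \<omega> \<partial>brw_space \<mu> x) =
      (\<integral>\<^sup>+\<omega>. (\<integral>\<^sup>+f. ?h f \<omega> * indicator {\<omega> []} f \<partial>count_space ?S) \<partial>brw_space \<mu> x)"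
    by (intro nn_integral_cong_AE) (auto simp: nn_integral_indicator_singleton)
  also have "\<dots> = (\<integral>\<^sup>+f. (\<integral>\<^sup>+\<omega>. ?h f \<omega> * indicator {\<omega> []} f \<partial>brw_space \<mu> x) \<partial>count_space ?S)"
  proof (rule nn_integral_count_space_nn_integral)
    fix f
    have "(\<lambda>\<omega>. F (fst p) (\<lambda>v. \<omega> (p # v))) \<in> borel_measurable (brw_space \<mu> x)" for p
      by (rule measurable_compose[OF measurable_subtree(2) F])
    moreover have "(\<lambda>\<omega>. indicator {\<omega> []} f :: ennreal) \<in> borel_measurable (brw_space \<mu> x)"
      by (rule measurable_compose[OF measurable_coordinate]) simp
    ultimately show "(\<lambda>\<omega>. ?h f \<omega> * indicator {\<omega> []} f) \<in> borel_measurable (brw_space \<mu> x)"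
      by (intro borel_measurable_times_ennreal borel_measurable_prod_ennreal)
  qed simp
  also have "\<dots> = (\<integral>\<^sup>+f. ennreal (pmf (\<mu> x) f) * ?k f \<partial>count_space ?S)"
    by (intro nn_integral_cong nn_integral_branching_given_root F) (simp add: fin)
  also have "\<dots> = (\<integral>\<^sup>+f. ennreal (pmf (\<mu> x) f) * ?k f \<partial>count_space UNIV)"
    by (rule nn_integral_count_space_eq) (auto simp: set_pmf_iff)
  also have "\<dots> = (\<integral>\<^sup>+f. ?k f \<partial>\<mu> x)"
    by (rule nn_integral_measure_pmf[symmetric])
  finally show ?thesis .
qed

lemma alive_take:
  assumes "brw_alive \<omega> u"
  shows "brw_alive \<omega> (take n u)"
  using assms alive_append[of \<omega> "take n u" "drop n u"] by simp

lemma not_alive_mono: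
  assumes "\<forall>u. length u = n \<longrightarrow> \<not> brw_alive \<omega> u" "n \<le> length u"
  shows "\<not> brw_alive \<omega> u"
  using assms alive_take[of \<omega> u n] by (metis length_take min.absorb2)

lemma extinct_subtree:
  assumes "extinct \<omega>" "brw_alive \<omega> u"
  shows "extinct (\<lambda>v. \<omega> (u @ v))"
proof -
  from assms(1) obtain n where n: "\<forall>u. length u = n \<longrightarrow> \<not> brw_alive \<omega> u"
    by (auto simp: extinct_def)
  have "\<not> brw_alive (\<lambda>v. \<omega> (u @ v)) v" if "length v = n" for v
    using not_alive_mono[OF n, of "u @ v"] that assms(2) by (simp add: alive_append)
  then show ?thesis by (auto simp: extinct_def)
qed

lemma finite_generation:
  assumes "\<And>u. fin_supp (\<omega> u)"
  shows "finite {u. brw_alive \<omega> u \<and> length u = n}"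
  using assms
proof (induction n arbitrary: \<omega>)
  case 0
  have "{u. brw_alive \<omega> u \<and> length u = 0} \<subseteq> {[]}" by auto
  then show ?case by (rule finite_subset) simp
next
  case (Suc n)
  have "{u. brw_alive \<omega> u \<and> length u = Suc n} \<subseteq>
      (\<Union>p\<in>offspring (\<omega> []). Cons p ` {v. brw_alive (\<lambda>v. \<omega> (p # v)) v \<and> length v = n})"
    by (auto simp: length_Suc_conv alive_Cons)
  moreover have "finite \<dots>"
    using Suc by (auto simp: finite_offspring_iff)
  ultimately show ?case by (rule finite_subset)
qed

lemma extinct_if_generation_extinct:
  assumes fin: "\<And>u. fin_supp (\<omega> u)"
    and ext: "\<And>u. brw_alive \<omega> u \<Longrightarrow> length u = n \<Longrightarrow> extinct (\<lambda>v. \<omega> (u @ v))"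
  shows "extinct \<omega>"
proof -
  let ?G = "{u. brw_alive \<omega> u \<and> length u = n}"
  have "\<forall>u\<in>?G. \<exists>m. \<forall>v. length v = m \<longrightarrow> \<not> brw_alive (\<lambda>v. \<omega> (u @ v)) v"
    using ext by (auto simp: extinct_def)
  then obtain m where m: "\<And>u. u \<in> ?G \<Longrightarrow> \<forall>v. length v = m u \<longrightarrow> \<not> brw_alive (\<lambda>v. \<omega> (u @ v)) v"
    by metis
  define k where "k = Max (insert 0 (m ` ?G))"
  have "\<not> brw_alive \<omega> w" if w: "length w = n + k" for w
  proof
    assume alive: "brw_alive \<omega> w"
    then have "take n w \<in> ?G"
      using w by (auto intro: alive_take)
    moreover from this have "m (take n w) \<le> k"
      unfolding k_def using finite_generation[OF fin] by (intro Max_ge) auto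
    ultimately show False
      using not_alive_mono[OF m, of "take n w" "drop n w"] alive w
        alive_append[of \<omega> "take n w" "drop n w"] by simp
  qed
  then show ?thesis by (auto simp: extinct_def)
qed

lemma measurable_subtree_pred:
  assumes "Measurable.pred (brw_space \<mu> y) P"
  shows "Measurable.pred (brw_space \<mu> x) (\<lambda>\<omega>. P (\<lambda>v. \<omega> (u @ v)))"
    and "Measurable.pred (brw_space \<mu> x) (\<lambda>\<omega>. P (\<lambda>v. \<omega> (p # v)))"
  by (rule measurable_compose[OF _ assms], rule measurable_subtree)+

lemma AE_subtree:
  assumes "AE \<omega> in brw_space \<mu> (brw_pos x u). P \<omega>"
  shows "AE \<omega> in brw_space \<mu> x. P (\<lambda>v. \<omega> (u @ v))"
  by (rule AE_distrD[OF measurable_subtree(1)[of u \<mu> x "brw_pos x u"]])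
     (subst distr_subtree, rule assms)

lemma measurable_offspring [measurable]:
  "Measurable.pred (brw_space \<mu> x) (\<lambda>\<omega>. p \<in> offspring (\<omega> u))"
  by (rule measurable_compose[OF measurable_coordinate]) simp

lemma brw_qbar_extinct: "brw_qbar \<mu> x = measure (brw_space \<mu> x) {\<omega>. extinct \<omega>}"
  by (simp add: brw_qbar_def extinct_def)

lemma offspring_prod_bounds:
  fixes z :: "'a \<Rightarrow> real"
  assumes "\<And>y. 0 \<le> z y" "\<And>y. z y \<le> 1"
  shows "0 \<le> (\<Prod>y\<in>S. z y ^ f y)" "(\<Prod>y\<in>S. z y ^ f y) \<le> 1"
  using assms by (auto intro!: prod_nonneg prod_le_1 power_le_one)

lemma integrable_brw_G:
  fixes z :: "'a \<Rightarrow> real"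
  assumes "\<And>y. 0 \<le> z y" "\<And>y. z y \<le> 1"
  shows "integrable (measure_pmf p) (\<lambda>f. \<Prod>y\<in>{y. f y \<noteq> 0}. z y ^ f y)"
  by (rule measure_pmf.integrable_const_bound[where B = 1])
     (use offspring_prod_bounds[of z, OF assms] in auto)

lemma brw_G_mono:
  assumes "\<And>y. 0 \<le> z y" "\<And>y. z y \<le> z' y" "\<And>y. z' y \<le> 1"
  shows "brw_G \<mu> z x \<le> brw_G \<mu> z' x"
  unfolding brw_G_def
proof (rule integral_mono)
  show "(\<Prod>y\<in>{y. f y \<noteq> 0}. z y ^ f y) \<le> (\<Prod>y\<in>{y. f y \<noteq> 0}. z' y ^ f y)" for f
    using assms by (intro prod_mono conjI power_mono) auto
qed (rule integrable_brw_G; use assms in \<open>blast intro: order_trans\<close>)+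

lemma prod_interpolate_le:
  fixes a :: "'i \<Rightarrow> real"
  assumes "finite S" "\<And>i. 0 \<le> a i" "\<And>i. a i \<le> 1" and t: "0 \<le> t" "t \<le> 1"
  shows "(\<Prod>i\<in>S. (1 - t) * a i + t) \<le> (1 - t) * (\<Prod>i\<in>S. a i) + t"
  using assms(1)
proof induction
  case (insert i S)
  let ?P = "\<Prod>i\<in>S. a i"
  have P: "0 \<le> ?P" "?P \<le> 1"
    using assms by (auto intro!: prod_nonneg prod_le_1)
  have "0 \<le> t * (1 - t) * (1 - a i) * (1 - ?P)"
    using assms P by simp
  then have "((1 - t) * a i + t) * ((1 - t) * ?P + t) \<le> (1 - t) * (a i * ?P) + t"
    by (simp add: algebra_simps)
  moreover have "((1 - t) * a i + t) * (\<Prod>i\<in>S. (1 - t) * a i + t) \<le> ((1 - t) * a i + t) * ((1 - t) * ?P + t)"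
    using assms by (intro mult_left_mono insert.IH) auto
  ultimately show ?case
    using insert by simp
qed simp

lemma brw_G_interpolate_le:
  assumes fin: "\<forall>f\<in>set_pmf (\<mu> x). fin_supp f"
    and z: "\<And>y. 0 \<le> z y" "\<And>y. z y \<le> 1" and t: "0 \<le> t" "t \<le> 1"
  shows "brw_G \<mu> (\<lambda>y. (1 - t) * z y + t) x \<le> (1 - t) * brw_G \<mu> z x + t"
proof -
  have w: "0 \<le> (1 - t) * z y + t" "(1 - t) * z y + t \<le> 1" for y
    using z[of y] t mult_left_mono[of "z y" 1 "1 - t"] by auto
  have "brw_G \<mu> (\<lambda>y. (1 - t) * z y + t) x \<le>
      measure_pmf.expectation (\<mu> x) (\<lambda>f. (1 - t) * (\<Prod>y\<in>{y. f y \<noteq> 0}. z y ^ f y) + t)"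
    unfolding brw_G_def
  proof (rule integral_mono_AE)
    show "AE f in \<mu> x. (\<Prod>y\<in>{y. f y \<noteq> 0}. ((1 - t) * z y + t) ^ f y) \<le>
        (1 - t) * (\<Prod>y\<in>{y. f y \<noteq> 0}. z y ^ f y) + t"
    proof (rule AE_pmfI)
      fix f assume "f \<in> set_pmf (\<mu> x)"
      then have f: "fin_supp f" using fin by blast
      show "(\<Prod>y\<in>{y. f y \<noteq> 0}. ((1 - t) * z y + t) ^ f y) \<le>
        (1 - t) * (\<Prod>y\<in>{y. f y \<noteq> 0}. z y ^ f y) + t"
        using prod_interpolate_le[of "offspring f" "\<lambda>p. z (fst p)" t] f z t
        by (simp add: finite_offspring_iff prod_offspring[OF f, of z]
          prod_offspring[OF f, of "\<lambda>y. (1 - t) * z y + t"])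
    qed
  qed (intro integrable_brw_G[OF w] Bochner_Integration.integrable_add integrable_mult_right
      integrable_brw_G[OF z] measure_pmf.integrable_const)+
  also have "\<dots> = (1 - t) * brw_G \<mu> z x + t"
    unfolding brw_G_def using integrable_brw_G[OF z, where p = "\<mu> x"] by simp
  finally show ?thesis .
qed

lemma prob_all_children:
  fixes \<mu> :: "'a::countable \<Rightarrow> ('a \<Rightarrow> nat) pmf"
  assumes fin: "\<forall>f\<in>set_pmf (\<mu> x). fin_supp f"
    and E [measurable]: "\<And>y. Measurable.pred (brw_space \<mu> y) (E y)"
  shows "measure (brw_space \<mu> x) {\<omega>. \<forall>p\<in>offspring (\<omega> []). E (fst p) (\<lambda>v. \<omega> (p # v))} =
    brw_G \<mu> (\<lambda>y. measure (brw_space \<mu> y) {\<omega>. E y \<omega>}) x"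
proof -
  interpret P: prob_space "brw_space \<mu> y" for y by (rule prob_space_brw_space)
  let ?C = "{\<omega>. \<forall>p\<in>offspring (\<omega> []). E (fst p) (\<lambda>v. \<omega> (p # v))}"
  let ?m = "\<lambda>y. measure (brw_space \<mu> y) {\<omega>. E y \<omega>}"
  have m: "0 \<le> ?m y" "?m y \<le> 1" for y by simp_all
  have sets_E: "{\<omega>. E y \<omega>} \<in> sets (brw_space \<mu> y)" for y
    using E[of y] by (simp add: pred_def)
  have "Measurable.pred (brw_space \<mu> x) (\<lambda>\<omega>. \<forall>p. p \<in> offspring (\<omega> []) \<longrightarrow> E (fst p) (\<lambda>v. \<omega> (p # v)))"
    by (intro pred_intros_countable pred_intros_logic measurable_offspring
        measurable_subtree_pred(2)[OF E])
  then have C: "?C \<in> sets (brw_space \<mu> x)"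
    by (simp add: pred_def Ball_def)
  have fin_root: "AE \<omega> in brw_space \<mu> x. fin_supp (\<omega> [])"
    using AE_coordinate_set_pmf[where u = "[]"] by eventually_elim (simp add: fin)
  have "ennreal (measure (brw_space \<mu> x) ?C) = (\<integral>\<^sup>+\<omega>. indicator ?C \<omega> \<partial>brw_space \<mu> x)"
    using C by (simp add: P.emeasure_eq_measure)
  also have "\<dots> = (\<integral>\<^sup>+\<omega>. (\<Prod>p\<in>offspring (\<omega> []). indicator {\<omega>. E (fst p) \<omega>} (\<lambda>v. \<omega> (p # v))) \<partial>brw_space \<mu> x)"
    using fin_root
  proof (intro nn_integral_cong_AE, eventually_elim)
    case (elim \<omega>)
    then have "finite (offspring (\<omega> []))" by (simp add: finite_offspring_iff)
    then show ?case
      by (cases "\<omega> \<in> ?C") (auto simp: indicator_def prod_zero_iff)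
  qed
  also have "\<dots> = (\<integral>\<^sup>+f. (\<Prod>p\<in>offspring f. \<integral>\<^sup>+\<omega>. indicator {\<omega>. E (fst p) \<omega>} \<omega> \<partial>brw_space \<mu> (fst p)) \<partial>\<mu> x)"
    by (rule nn_integral_branching) (use fin sets_E in auto)
  also have "\<dots> = (\<integral>\<^sup>+f. ennreal (\<Prod>y\<in>{y. f y \<noteq> 0}. ?m y ^ f y) \<partial>\<mu> x)"
  proof (intro nn_integral_cong_AE AE_pmfI)
    fix f assume "f \<in> set_pmf (\<mu> x)"
    then have f: "fin_supp f" using fin by blast
    show "(\<Prod>p\<in>offspring f. \<integral>\<^sup>+\<omega>. indicator {\<omega>. E (fst p) \<omega>} \<omega> \<partial>brw_space \<mu> (fst p)) =
        ennreal (\<Prod>y\<in>{y. f y \<noteq> 0}. ?m y ^ f y)"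
      unfolding prod_offspring[OF f, of ?m, symmetric]
      using sets_E by (simp add: P.emeasure_eq_measure prod_ennreal)
  qed
  also have "\<dots> = ennreal (brw_G \<mu> ?m x)"
    unfolding brw_G_def
    by (intro nn_integral_eq_integral integrable_brw_G AE_I2 offspring_prod_bounds m)
  finally have "ennreal (measure (brw_space \<mu> x) ?C) = ennreal (brw_G \<mu> ?m x)" .
  moreover have "0 \<le> brw_G \<mu> ?m x"
    unfolding brw_G_def by (intro Bochner_Integration.integral_nonneg offspring_prod_bounds m)
  ultimately show ?thesis by simp
qed

definition first_hit :: "'a set \<Rightarrow> 'a \<Rightarrow> (('a \<times> nat) list \<Rightarrow> 'a \<Rightarrow> nat) \<Rightarrow> ('a \<times> nat) list \<Rightarrow> bool" where
  "first_hit A x \<omega> u \<longleftrightarrow>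
    brw_alive \<omega> u \<and> brw_pos x u \<in> A \<and> (\<forall>i<length u. brw_pos x (take i u) \<notin> A)"

definition hits_extinct :: "'a set \<Rightarrow> nat \<Rightarrow> 'a \<Rightarrow> (('a \<times> nat) list \<Rightarrow> 'a \<Rightarrow> nat) \<Rightarrow> bool" where
  "hits_extinct A n x \<omega> \<longleftrightarrow>
    (\<forall>u. length u < n \<and> brw_alive \<omega> u \<and> brw_pos x u \<in> A \<longrightarrow> extinct (\<lambda>v. \<omega> (u @ v)))"

text \<open>The product of \<open>1[extinct] / c\<close> over the first hits of \<open>A\<close> before generation \<open>n\<close>.\<close>
primrec hit_weight :: "'a set \<Rightarrow> real \<Rightarrow> nat \<Rightarrow> 'a \<Rightarrow> (('a \<times> nat) list \<Rightarrow> 'a \<Rightarrow> nat) \<Rightarrow> ennreal" where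
  "hit_weight A c 0 = (\<lambda>x \<omega>. 1)"
| "hit_weight A c (Suc n) = (\<lambda>x \<omega>.
    if x \<in> A then ennreal (1 / c) * indicator {\<omega>. extinct \<omega>} \<omega>
    else \<Prod>p\<in>offspring (\<omega> []). hit_weight A c n (fst p) (\<lambda>v. \<omega> (p # v)))"

lemma hits_extinct_Suc_in:
  assumes "x \<in> A"
  shows "hits_extinct A (Suc n) x \<omega> \<longleftrightarrow> extinct \<omega>"
proof
  assume "hits_extinct A (Suc n) x \<omega>"
  then show "extinct \<omega>"
    unfolding hits_extinct_def using assms by (auto dest!: spec[of _ "[]"])
qed (auto simp: hits_extinct_def intro: extinct_subtree)

lemma hits_extinct_Suc_notin:
  assumes "x \<notin> A"
  shows "hits_extinct A (Suc n) x \<omega> \<longleftrightarrow>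
    (\<forall>p\<in>offspring (\<omega> []). hits_extinct A n (fst p) (\<lambda>v. \<omega> (p # v)))"
proof -
  have "(\<forall>u. P u) \<longleftrightarrow> P [] \<and> (\<forall>p u. P (p # u))" for P :: "('a \<times> nat) list \<Rightarrow> bool"
    by (metis list.exhaust)
  from this[of "\<lambda>u. length u < Suc n \<and> brw_alive \<omega> u \<and> brw_pos x u \<in> A \<longrightarrow> extinct (\<lambda>v. \<omega> (u @ v))"]
  show ?thesis
    using assms by (auto simp: hits_extinct_def alive_Cons pos_Cons)
qed

lemma measurable_hits_extinct:
  fixes \<mu> :: "'a::countable \<Rightarrow> ('a \<Rightarrow> nat) pmf"
  shows "Measurable.pred (brw_space \<mu> x) (hits_extinct A n y)"
  unfolding hits_extinct_def[abs_def]
  by (intro pred_intros_countable pred_intros_logic measurable_alive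
      measurable_subtree_pred(1)[OF measurable_extinct]) simp_all

lemma measurable_prod_offspring:
  fixes \<mu> :: "'a::countable \<Rightarrow> ('a \<Rightarrow> nat) pmf" and F :: "'a \<Rightarrow> _ \<Rightarrow> ennreal"
  assumes F: "\<And>y. F y \<in> borel_measurable (brw_space \<mu> y)"
  shows "(\<lambda>\<omega>. \<Prod>p\<in>offspring (\<omega> []). F (fst p) (\<lambda>v. \<omega> (p # v))) \<in> borel_measurable (brw_space \<mu> x)"
proof -
  define g :: "('a \<Rightarrow> nat) \<Rightarrow> 'a \<Rightarrow> nat" where "g f = (if fin_supp f then f else (\<lambda>_. 0))" for f
  have "(\<lambda>\<omega>. \<Prod>p\<in>offspring (g (\<omega> [])). F (fst p) (\<lambda>v. \<omega> (p # v))) \<in> borel_measurable (brw_space \<mu> x)"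
  proof (rule measurable_compose_countable'[where g = "\<lambda>\<omega>. g (\<omega> [])" and I = "{f. fin_supp f}"
        and f = "\<lambda>f \<omega>. \<Prod>p\<in>offspring f. F (fst p) (\<lambda>v. \<omega> (p # v))"])
    show "(\<lambda>\<omega>. \<Prod>p\<in>offspring f. F (fst p) (\<lambda>v. \<omega> (p # v))) \<in> borel_measurable (brw_space \<mu> x)" for f
      by (intro borel_measurable_prod_ennreal measurable_compose[OF measurable_subtree(2) F])
    show "(\<lambda>\<omega>. g (\<omega> [])) \<in> measurable (brw_space \<mu> x) (count_space {f. fin_supp f})"
      by (rule measurable_compose[OF measurable_coordinate]) (auto simp: g_def fin_supp_def)
  qed (rule countable_fin_supp)
  moreover have "(\<Prod>p\<in>offspring (g f). h p) = (\<Prod>p\<in>offspring f. h p)" for f and h :: "_ \<Rightarrow> ennreal"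
  proof (cases "fin_supp f")
    case False
    then have "infinite (offspring f)" by (simp add: finite_offspring_iff)
    moreover have "offspring (g f) = {}" using False by (simp add: g_def offspring_def)
    ultimately show ?thesis by simp
  qed (simp add: g_def)
  ultimately show ?thesis by simp
qed

lemma measurable_hit_weight:
  fixes \<mu> :: "'a::countable \<Rightarrow> ('a \<Rightarrow> nat) pmf"
  shows "hit_weight A c n y \<in> borel_measurable (brw_space \<mu> x)"
proof (induction n arbitrary: x y)
  case (Suc n)
  show ?case
  proof (cases "y \<in> A")
    case True
    have "{\<omega>. extinct \<omega>} \<in> sets (brw_space \<mu> x)"
      using measurable_extinct[of \<mu> x] by (simp add: pred_def)
    then show ?thesis using True by simp
  next
    case False
    then show ?thesis
      using measurable_prod_offspring[of "hit_weight A c n" \<mu> x, OF Suc] by simp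
  qed
qed simp

lemma nn_integral_hit_weight_le_1:
  fixes \<mu> :: "'a::countable \<Rightarrow> ('a \<Rightarrow> nat) pmf"
  assumes fin: "\<forall>x. \<forall>f\<in>set_pmf (\<mu> x). fin_supp f"
    and c: "0 < c" "\<And>x. x \<in> A \<Longrightarrow> brw_qbar \<mu> x \<le> c"
  shows "(\<integral>\<^sup>+\<omega>. hit_weight A c n x \<omega> \<partial>brw_space \<mu> x) \<le> 1"
proof (induction n arbitrary: x)
  case 0
  show ?case
    using prob_space.emeasure_space_1[OF prob_space_brw_space, of \<mu> x] by simp
next
  case (Suc n)
  interpret P: prob_space "brw_space \<mu> x" by (rule prob_space_brw_space)
  show ?case
  proof (cases "x \<in> A")
    case True
    have ext: "{\<omega>. extinct \<omega>} \<in> sets (brw_space \<mu> x)"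
      using measurable_extinct[of \<mu> x] by (simp add: pred_def)
    then have "(\<integral>\<^sup>+\<omega>. hit_weight A c (Suc n) x \<omega> \<partial>brw_space \<mu> x) = ennreal (1 / c) * ennreal (brw_qbar \<mu> x)"
      using True by (simp add: nn_integral_cmult_indicator P.emeasure_eq_measure brw_qbar_extinct)
    also have "\<dots> = ennreal (brw_qbar \<mu> x / c)"
      using c by (subst ennreal_mult[symmetric]) (auto simp: brw_qbar_extinct)
    also have "\<dots> \<le> ennreal 1"
      using c(1) c(2)[OF True] by (intro ennreal_leI) simp
    finally show ?thesis by simp
  next
    case False
    then have "(\<integral>\<^sup>+\<omega>. hit_weight A c (Suc n) x \<omega> \<partial>brw_space \<mu> x) =
        (\<integral>\<^sup>+f. (\<Prod>p\<in>offspring f. \<integral>\<^sup>+\<omega>. hit_weight A c n (fst p) \<omega> \<partial>brw_space \<mu> (fst p)) \<partial>\<mu> x)"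
      using nn_integral_branching[of \<mu> x "hit_weight A c n", OF spec[OF fin] measurable_hit_weight] by simp
    also have "\<dots> \<le> (\<integral>\<^sup>+f. 1 \<partial>\<mu> x)"
      using Suc by (intro nn_integral_mono prod_le_1) auto
    finally show ?thesis by simp
  qed
qed

lemma hit_weight_ge:
  assumes fin: "\<And>u. fin_supp (\<omega> u)" and c: "0 < c" "c \<le> 1"
    and "hits_extinct A n x \<omega>" "finite S" "\<And>u. u \<in> S \<Longrightarrow> first_hit A x \<omega> u \<and> length u < n"
  shows "ennreal (1 / c) ^ card S \<le> hit_weight A c n x \<omega>"
  using fin assms(4-)
proof (induction n arbitrary: x \<omega> S)
  case 0
  then have "S = {}" by auto
  then show ?case by simp
next
  case (Suc n)
  have ge1: "1 \<le> ennreal (1 / c)"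
    using c by (simp add: ennreal_1[symmetric] del: ennreal_1)
  show ?case
  proof (cases "x \<in> A")
    case True
    have "S \<subseteq> {[]}"
    proof
      fix u assume "u \<in> S"
      then have "first_hit A x \<omega> u" using Suc.prems(4) by blast
      then show "u \<in> {[]}"
        using True by (cases u) (auto simp: first_hit_def)
    qed
    then have "card S \<le> 1"
      using card_mono[of "{[]}" S] by simp
    then have "ennreal (1 / c) ^ card S \<le> ennreal (1 / c) ^ 1"
      by (rule power_increasing) (rule ge1)
    moreover have "extinct \<omega>"
      using Suc.prems(2) True by (simp add: hits_extinct_Suc_in)
    ultimately show ?thesis using True by simp
  next
    case False
    define T where "T p = {v. p # v \<in> S}" for p
    have finT: "finite (T p)" for p
      unfolding T_def using Suc.prems(3) by (rule finite_vimageI[where h = "Cons p", unfolded vimage_def]) simp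
    have finO: "finite (offspring (\<omega> []))"
      using Suc.prems(1) by (simp add: finite_offspring_iff)
    have "S \<subseteq> (\<Union>p\<in>offspring (\<omega> []). Cons p ` T p)"
    proof
      fix u assume u: "u \<in> S"
      then have hit: "first_hit A x \<omega> u" using Suc.prems(4) by blast
      then obtain p v where "u = p # v"
        using False by (cases u) (auto simp: first_hit_def)
      then show "u \<in> (\<Union>p\<in>offspring (\<omega> []). Cons p ` T p)"
        using hit u by (auto simp: T_def first_hit_def alive_Cons)
    qed
    then have "card S \<le> card (\<Union>p\<in>offspring (\<omega> []). Cons p ` T p)"
      using finO finT by (intro card_mono) auto
    also have "\<dots> \<le> (\<Sum>p\<in>offspring (\<omega> []). card (Cons p ` T p))"
      using finO by (rule card_UN_le)
    also have "\<dots> = (\<Sum>p\<in>offspring (\<omega> []). card (T p))"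
      by (intro sum.cong card_image) auto
    finally have "ennreal (1 / c) ^ card S \<le> ennreal (1 / c) ^ (\<Sum>p\<in>offspring (\<omega> []). card (T p))"
      by (rule power_increasing) (rule ge1)
    also have "\<dots> = (\<Prod>p\<in>offspring (\<omega> []). ennreal (1 / c) ^ card (T p))"
      by (rule power_sum)
    also have "\<dots> \<le> (\<Prod>p\<in>offspring (\<omega> []). hit_weight A c n (fst p) (\<lambda>v. \<omega> (p # v)))"
    proof (rule prod_mono_ennreal)
      fix p assume p: "p \<in> offspring (\<omega> [])"
      show "ennreal (1 / c) ^ card (T p) \<le> hit_weight A c n (fst p) (\<lambda>v. \<omega> (p # v))"
      proof (rule Suc.IH)
        show "hits_extinct A n (fst p) (\<lambda>v. \<omega> (p # v))"
          using Suc.prems(2) False p by (simp add: hits_extinct_Suc_notin)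
        fix v assume "v \<in> T p"
        then have "first_hit A x \<omega> (p # v)" and "length (p # v) < Suc n"
          using Suc.prems(4)[of "p # v"] by (auto simp: T_def)
        then show "first_hit A (fst p) (\<lambda>v. \<omega> (p # v)) v \<and> length v < n"
          by (auto simp: first_hit_def alive_Cons pos_Cons dest: spec[of _ "Suc _"])
      qed (use Suc.prems(1) finT in auto)
    qed
    finally show ?thesis using False by simp
  qed
qed

lemma finitely_many_visits:
  assumes ext: "\<And>n. hits_extinct A n x \<omega>" and fin: "finite {u. first_hit A x \<omega> u}"
  shows "\<exists>n. \<forall>u. brw_alive \<omega> u \<and> n \<le> length u \<longrightarrow> brw_pos x u \<notin> A"
proof -
  let ?H = "{u. first_hit A x \<omega> u}"
  have "\<forall>u\<in>?H. extinct (\<lambda>v. \<omega> (u @ v))"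
    using ext by (auto simp: hits_extinct_def first_hit_def)
  then have "\<forall>u\<in>?H. \<exists>m. \<forall>v. length v = m \<longrightarrow> \<not> brw_alive (\<lambda>v. \<omega> (u @ v)) v"
    by (auto simp: extinct_def)
  then obtain m where m: "\<And>u. u \<in> ?H \<Longrightarrow> \<forall>v. length v = m u \<longrightarrow> \<not> brw_alive (\<lambda>v. \<omega> (u @ v)) v"
    by metis
  define N where "N = Max (insert 0 ((\<lambda>u. length u + m u) ` ?H))"
  have "brw_pos x w \<notin> A" if w: "brw_alive \<omega> w" "N \<le> length w" for w
  proof
    assume "brw_pos x w \<in> A"
    then have ex: "\<exists>i. i \<le> length w \<and> brw_pos x (take i w) \<in> A"
      by (intro exI[of _ "length w"]) simp
    define i where "i = (LEAST i. i \<le> length w \<and> brw_pos x (take i w) \<in> A)"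
    have i: "i \<le> length w" "brw_pos x (take i w) \<in> A"
      using LeastI_ex[OF ex] by (auto simp: i_def)
    have least: "brw_pos x (take j w) \<notin> A" if "j < i" for j
      using not_less_Least[of j "\<lambda>i. i \<le> length w \<and> brw_pos x (take i w) \<in> A"] that i(1)
      by (auto simp: i_def)
    have H: "take i w \<in> ?H"
      using i least w(1) by (auto simp: first_hit_def alive_take min_def)
    have "(\<lambda>u. length u + m u) (take i w) \<le> N"
      unfolding N_def by (intro Max_ge insertI2 imageI H) (simp add: fin)
    then show False
      using not_alive_mono[OF m[OF H], of "drop i w"] w i
        alive_append[of \<omega> "take i w" "drop i w"] by simp
  qed
  then show ?thesis by blast
qed

lemma measurable_finite_visits:
  fixes \<mu> :: "'a::countable \<Rightarrow> ('a \<Rightarrow> nat) pmf"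
  shows "{\<omega>. \<exists>n. \<forall>u. brw_alive \<omega> u \<and> n \<le> length u \<longrightarrow> brw_pos x u \<noteq> y} \<in> sets (brw_space \<mu> x)"
proof -
  have "Measurable.pred (brw_space \<mu> x) (\<lambda>\<omega>. \<exists>n. \<forall>u. brw_alive \<omega> u \<and> n \<le> length u \<longrightarrow> brw_pos x u \<noteq> y)"
    by (intro pred_intros_countable pred_intros_logic measurable_alive) simp_all
  then show ?thesis by (simp add: pred_def)
qed

lemma AE_fin_supp:
  fixes \<mu> :: "'a::countable \<Rightarrow> ('a \<Rightarrow> nat) pmf"
  assumes fin: "\<forall>x. \<forall>f\<in>set_pmf (\<mu> x). fin_supp f"
  shows "AE \<omega> in brw_space \<mu> x. \<forall>u. fin_supp (\<omega> u)"
proof (subst AE_all_countable, rule allI)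
  fix u
  show "AE \<omega> in brw_space \<mu> x. fin_supp (\<omega> u)"
    using AE_coordinate_set_pmf[where u = u] by eventually_elim (use fin in blast)
qed

lemma qbar_le_q:
  fixes \<mu> :: "'a::countable \<Rightarrow> ('a \<Rightarrow> nat) pmf"
  shows "brw_qbar \<mu> x \<le> brw_q \<mu> x y"
proof -
  interpret P: prob_space "brw_space \<mu> x" by (rule prob_space_brw_space)
  have "brw_qbar \<mu> x \<le> measure (brw_space \<mu> x)
      {\<omega>. \<exists>n. \<forall>u. brw_alive \<omega> u \<and> n \<le> length u \<longrightarrow> brw_pos x u \<noteq> y}"
    unfolding brw_qbar_extinct
  proof (rule P.finite_measure_mono[OF _ measurable_finite_visits], safe)
    fix \<omega> :: "('a \<times> nat) list \<Rightarrow> 'a \<Rightarrow> nat" assume "extinct \<omega>"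
    then obtain n where "\<forall>u. length u = n \<longrightarrow> \<not> brw_alive \<omega> u" by (auto simp: extinct_def)
    then show "\<exists>n. \<forall>u. brw_alive \<omega> u \<and> n \<le> length u \<longrightarrow> brw_pos x u \<noteq> y"
      by (auto dest: not_alive_mono)
  qed
  then show ?thesis by (simp add: brw_q_def)
qed

lemma AE_finitely_many_first_hits:
  fixes \<mu> :: "'a::countable \<Rightarrow> ('a \<Rightarrow> nat) pmf"
  assumes fin: "\<forall>x. \<forall>f\<in>set_pmf (\<mu> x). fin_supp f"
    and A: "finite A" "\<forall>x\<in>A. brw_qbar \<mu> x < 1"
  shows "AE \<omega> in brw_space \<mu> x. (\<forall>n. hits_extinct A n x \<omega>) \<longrightarrow> finite {u. first_hit A x \<omega> u}"
proof -
  define c where "c = Max (insert (1 / 2) (brw_qbar \<mu> ` A))"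
  have c: "0 < c" "c < 1" "\<And>x. x \<in> A \<Longrightarrow> brw_qbar \<mu> x \<le> c"
    using A by (auto simp: c_def Max_less_iff less_max_iff_disj intro: Max_ge less_le_trans[OF _ Max_ge[where x = "1 / 2"]])
  let ?L = "\<lambda>\<omega>. liminf (\<lambda>n. hit_weight A c n x \<omega>)"
  have meas: "?L \<in> borel_measurable (brw_space \<mu> x)"
    by (intro borel_measurable_liminf measurable_hit_weight)
  have "(\<integral>\<^sup>+\<omega>. ?L \<omega> \<partial>brw_space \<mu> x) \<le> liminf (\<lambda>n. \<integral>\<^sup>+\<omega>. hit_weight A c n x \<omega> \<partial>brw_space \<mu> x)"
    by (intro nn_integral_liminf measurable_hit_weight)
  also have "\<dots> \<le> liminf (\<lambda>n. 1 :: ennreal)"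
    using nn_integral_hit_weight_le_1[OF fin c(1,3)] by (intro Liminf_mono always_eventually) auto
  finally have "(\<integral>\<^sup>+\<omega>. ?L \<omega> \<partial>brw_space \<mu> x) \<le> 1"
    by (simp add: Liminf_const)
  then have "(\<integral>\<^sup>+\<omega>. ?L \<omega> \<partial>brw_space \<mu> x) \<noteq> \<infinity>"
    by (auto simp: top_unique)
  from nn_integral_PInf_AE[OF meas this] AE_fin_supp[OF fin, where x = x]
  show ?thesis
  proof eventually_elim
    case (elim \<omega>)
    show ?case
    proof (rule impI, rule ccontr)
      assume ext: "\<forall>n. hits_extinct A n x \<omega>" and inf: "infinite {u. first_hit A x \<omega> u}"
      from elim(1) obtain r where r: "?L \<omega> = ennreal r" "0 \<le> r"
        by (cases "?L \<omega>") auto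
      have "1 < 1 / c" using c by simp
      then obtain k where k: "r < (1 / c) ^ k"
        using real_arch_pow by blast
      obtain S where S: "finite S" "card S = k" "S \<subseteq> {u. first_hit A x \<omega> u}"
        using infinite_arbitrarily_large[OF inf] by blast
      obtain N where N: "\<And>u. u \<in> S \<Longrightarrow> length u < N"
        using S(1) finite_nat_set_iff_bounded[of "length ` S"] by auto
      have "\<forall>\<^sub>F n in sequentially. ennreal (1 / c) ^ k \<le> hit_weight A c n x \<omega>"
        using eventually_ge_at_top[of N]
      proof eventually_elim
        case (elim n)
        have "ennreal (1 / c) ^ card S \<le> hit_weight A c n x \<omega>"
          by (rule hit_weight_ge)
             (use S N ext c elim \<open>\<forall>u. fin_supp (\<omega> u)\<close> in \<open>auto intro: less_le_trans\<close>)
        then show ?case using S by simp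
      qed
      then have "ennreal (1 / c) ^ k \<le> ?L \<omega>"
        by (rule Liminf_bounded)
      then have "ennreal ((1 / c) ^ k) \<le> ennreal r"
        using c(1) by (simp add: r ennreal_power)
      then show False
        using k r by (simp add: ennreal_le_iff)
    qed
  qed
qed

lemma prob_hits_extinct_le_q:
  fixes \<mu> :: "'a::countable \<Rightarrow> ('a \<Rightarrow> nat) pmf"
  assumes fin: "\<forall>x. \<forall>f\<in>set_pmf (\<mu> x). fin_supp f"
    and A: "finite A" "\<forall>x\<in>A. brw_qbar \<mu> x < 1" and y: "y \<in> A"
  shows "measure (brw_space \<mu> x) {\<omega>. \<forall>n. hits_extinct A n x \<omega>} \<le> brw_q \<mu> x y"
proof -
  interpret P: prob_space "brw_space \<mu> x" by (rule prob_space_brw_space)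
  have "measure (brw_space \<mu> x) {\<omega>. \<forall>n. hits_extinct A n x \<omega>} \<le> measure (brw_space \<mu> x)
      {\<omega>. \<exists>n. \<forall>u. brw_alive \<omega> u \<and> n \<le> length u \<longrightarrow> brw_pos x u \<noteq> y}"
  proof (rule P.finite_measure_mono_AE[OF _ measurable_finite_visits])
    show "AE \<omega> in brw_space \<mu> x. \<omega> \<in> {\<omega>. \<forall>n. hits_extinct A n x \<omega>} \<longrightarrow>
        \<omega> \<in> {\<omega>. \<exists>n. \<forall>u. brw_alive \<omega> u \<and> n \<le> length u \<longrightarrow> brw_pos x u \<noteq> y}"
      using AE_finitely_many_first_hits[OF fin A, where x = x]
    proof eventually_elim
      case (elim \<omega>)
      show ?case
      proof
        assume "\<omega> \<in> {\<omega>. \<forall>n. hits_extinct A n x \<omega>}"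
        then have "\<exists>n. \<forall>u. brw_alive \<omega> u \<and> n \<le> length u \<longrightarrow> brw_pos x u \<notin> A"
          using elim by (intro finitely_many_visits) auto
        then show "\<omega> \<in> {\<omega>. \<exists>n. \<forall>u. brw_alive \<omega> u \<and> n \<le> length u \<longrightarrow> brw_pos x u \<noteq> y}"
          using y by blast
      qed
    qed
  qed
  then show ?thesis by (simp add: brw_q_def)
qed

lemma subsolution_le_hits_extinct:
  fixes \<mu> :: "'a::countable \<Rightarrow> ('a \<Rightarrow> nat) pmf"
  assumes fin: "\<forall>x. \<forall>f\<in>set_pmf (\<mu> x). fin_supp f"
    and v: "\<And>x. 0 \<le> v x" "\<And>x. v x \<le> 1" "\<And>x. x \<notin> A \<Longrightarrow> v x \<le> brw_G \<mu> v x"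
    and t: "0 \<le> t" "t \<le> 1" "\<And>x. x \<in> A \<Longrightarrow> v x \<le> (1 - t) * brw_qbar \<mu> x + t"
  shows "v x \<le> (1 - t) * measure (brw_space \<mu> x) {\<omega>. \<forall>n. hits_extinct A n x \<omega>} + t"
proof -
  interpret P: prob_space "brw_space \<mu> z" for z by (rule prob_space_brw_space)
  let ?D = "\<lambda>n x. {\<omega>. hits_extinct A n x \<omega>}"
  let ?d = "\<lambda>n x. measure (brw_space \<mu> x) (?D n x)"
  have step: "v x \<le> (1 - t) * ?d n x + t" for n x
  proof (induction n arbitrary: x)
    case 0
    have "?D 0 x = space (brw_space \<mu> x)" by (auto simp: hits_extinct_def)
    then show ?case using v(2)[of x] by (simp add: P.prob_space del: space_brw_space)
  next
    case (Suc n)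
    show ?case
    proof (cases "x \<in> A")
      case True
      then show ?thesis using t(3)[OF True] by (simp add: hits_extinct_Suc_in brw_qbar_extinct)
    next
      case False
      have "(1 - t) * ?d n y \<le> (1 - t) * 1" for y
        using t by (intro mult_left_mono) auto
      then have "brw_G \<mu> v x \<le> brw_G \<mu> (\<lambda>y. (1 - t) * ?d n y + t) x"
        using v Suc by (intro brw_G_mono) (auto simp: algebra_simps)
      also have "\<dots> \<le> (1 - t) * brw_G \<mu> (?d n) x + t"
        using fin t by (intro brw_G_interpolate_le) auto
      also have "brw_G \<mu> (?d n) x = ?d (Suc n) x"
        using prob_all_children[of \<mu> x "hits_extinct A n", OF spec[OF fin] measurable_hits_extinct] False
        by (simp add: hits_extinct_Suc_notin)
      finally show ?thesis using v(3)[OF False] by simp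
    qed
  qed
  have "decseq (\<lambda>n. ?D n x)"
    by (intro decseq_SucI) (auto simp: hits_extinct_def)
  moreover have "range (\<lambda>n. ?D n x) \<subseteq> sets (brw_space \<mu> x)"
    using measurable_hits_extinct[where \<mu> = \<mu> and x = x and y = x and A = A] by (auto simp: pred_def)
  ultimately have "(\<lambda>n. ?d n x) \<longlonglongrightarrow> measure (brw_space \<mu> x) (\<Inter>n. ?D n x)"
    by (intro P.finite_Lim_measure_decseq)
  moreover have "(\<Inter>n. ?D n x) = {\<omega>. \<forall>n. hits_extinct A n x \<omega>}" by auto
  ultimately have lim: "(\<lambda>n. (1 - t) * ?d n x + t) \<longlonglongrightarrow>
      (1 - t) * measure (brw_space \<mu> x) {\<omega>. \<forall>n. hits_extinct A n x \<omega>} + t"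
    by (intro tendsto_intros) simp
  show ?thesis
    by (rule tendsto_lowerbound[OF lim]) (use step in auto)
qed

definition avoids :: "'a \<Rightarrow> 'a \<Rightarrow> (('a \<times> nat) list \<Rightarrow> 'a \<Rightarrow> nat) \<Rightarrow> bool" where
  "avoids y x \<omega> \<longleftrightarrow> (\<forall>u. brw_alive \<omega> u \<longrightarrow> brw_pos x u \<noteq> y)"

lemma measurable_avoids:
  fixes \<mu> :: "'a::countable \<Rightarrow> ('a \<Rightarrow> nat) pmf"
  shows "Measurable.pred (brw_space \<mu> x) (avoids y z)"
  unfolding avoids_def[abs_def]
  by (intro pred_intros_countable pred_intros_logic measurable_alive) simp_all

lemma q_le_qbar_if_avoids_extinct:
  fixes \<mu> :: "'a::countable \<Rightarrow> ('a \<Rightarrow> nat) pmf"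
  assumes fin: "\<forall>x. \<forall>f\<in>set_pmf (\<mu> x). fin_supp f"
    and ext: "\<And>z. AE \<omega> in brw_space \<mu> z. avoids y z \<omega> \<longrightarrow> extinct \<omega>"
  shows "brw_q \<mu> x y \<le> brw_qbar \<mu> x"
proof -
  interpret P: prob_space "brw_space \<mu> x" by (rule prob_space_brw_space)
  have "AE \<omega> in brw_space \<mu> x. \<forall>u. avoids y (brw_pos x u) (\<lambda>v. \<omega> (u @ v)) \<longrightarrow> extinct (\<lambda>v. \<omega> (u @ v))"
    by (subst AE_all_countable, intro allI AE_subtree ext)
  then have AE: "AE \<omega> in brw_space \<mu> x.
      (\<exists>n. \<forall>u. brw_alive \<omega> u \<and> n \<le> length u \<longrightarrow> brw_pos x u \<noteq> y) \<longrightarrow> extinct \<omega>"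
    using AE_fin_supp[OF fin, where x = x]
  proof eventually_elim
    case (elim \<omega>)
    show ?case
    proof
      assume "\<exists>n. \<forall>u. brw_alive \<omega> u \<and> n \<le> length u \<longrightarrow> brw_pos x u \<noteq> y"
      then obtain n where n: "\<And>u. brw_alive \<omega> u \<Longrightarrow> n \<le> length u \<Longrightarrow> brw_pos x u \<noteq> y" by blast
      show "extinct \<omega>"
      proof (rule extinct_if_generation_extinct)
        fix u assume u: "brw_alive \<omega> u" "length u = n"
        have "avoids y (brw_pos x u) (\<lambda>v. \<omega> (u @ v))"
          unfolding avoids_def using n[of "u @ _"] u by (auto simp: alive_append pos_append)
        then show "extinct (\<lambda>v. \<omega> (u @ v))" using elim(1) by blast
      qed (use elim(2) in blast)
    qed
  qed
  have sets_ext: "{\<omega>. extinct \<omega>} \<in> sets (brw_space \<mu> x)"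
    using measurable_extinct[of \<mu> x] by (simp add: pred_def)
  have "measure (brw_space \<mu> x) {\<omega>. \<exists>n. \<forall>u. brw_alive \<omega> u \<and> n \<le> length u \<longrightarrow> brw_pos x u \<noteq> y} \<le>
      measure (brw_space \<mu> x) {\<omega>. extinct \<omega>}"
    by (rule P.finite_measure_mono_AE[OF _ sets_ext]) (use AE in simp)
  then show ?thesis by (simp add: brw_q_def brw_qbar_extinct)
qed

lemma separating_function_if_q_neq_qbar:
  fixes \<mu> :: "'a::countable \<Rightarrow> ('a \<Rightarrow> nat) pmf"
  assumes fin: "\<forall>x. \<forall>f\<in>set_pmf (\<mu> x). fin_supp f"
    and qbar: "\<And>x. brw_qbar \<mu> x < 1" and neq: "brw_q \<mu> x y \<noteq> brw_qbar \<mu> x"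
  obtains v x0 where "\<And>x. 0 \<le> v x" "\<And>x. v x \<le> 1" "\<And>x. brw_qbar \<mu> x \<le> v x"
    "\<And>x. x \<noteq> y \<Longrightarrow> v x \<le> brw_G \<mu> v x" "x0 \<noteq> y" "brw_tau \<mu> v y < brw_tau \<mu> v x0"
proof -
  interpret P: prob_space "brw_space \<mu> z" for z by (rule prob_space_brw_space)
  let ?E = "\<lambda>z \<omega>. avoids y z \<omega> \<or> extinct \<omega>"
  define v where "v z = measure (brw_space \<mu> z) {\<omega>. ?E z \<omega>}" for z
  have pred_E: "Measurable.pred (brw_space \<mu> z) (?E z')" for z z'
    by (intro pred_intros_logic measurable_avoids measurable_extinct)
  have sets_E: "{\<omega>. ?E z \<omega>} \<in> sets (brw_space \<mu> z)" for z
    using pred_E[of z z] by (simp add: pred_def)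
  have sets_ext: "{\<omega>. extinct \<omega>} \<in> sets (brw_space \<mu> z)" for z
    using measurable_extinct[of \<mu> z] by (simp add: pred_def)
  have ge: "brw_qbar \<mu> z \<le> v z" for z
    unfolding brw_qbar_extinct v_def by (rule P.finite_measure_mono[OF _ sets_E]) auto
  have "\<not> avoids y y \<omega>" for \<omega> :: "('a \<times> nat) list \<Rightarrow> 'a \<Rightarrow> nat"
    by (auto simp: avoids_def intro!: exI[of _ "[]"])
  then have vy: "v y = brw_qbar \<mu> y"
    by (simp add: v_def brw_qbar_extinct)
  have sub: "v z \<le> brw_G \<mu> v z" if "z \<noteq> y" for z
  proof -
    have "v z \<le> measure (brw_space \<mu> z) {\<omega>. \<forall>p\<in>offspring (\<omega> []). ?E (fst p) (\<lambda>v. \<omega> (p # v))}"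
      unfolding v_def
    proof (rule P.finite_measure_mono)
      show "{\<omega>. ?E z \<omega>} \<subseteq> {\<omega>. \<forall>p\<in>offspring (\<omega> []). ?E (fst p) (\<lambda>v. \<omega> (p # v))}"
      proof (intro subsetI CollectI ballI)
        fix \<omega> p assume "\<omega> \<in> {\<omega>. ?E z \<omega>}" and p: "p \<in> offspring (\<omega> [])"
        then consider "avoids y z \<omega>" | "extinct \<omega>" by blast
        then show "?E (fst p) (\<lambda>v. \<omega> (p # v))"
        proof cases
          case 1
          have "brw_pos (fst p) u \<noteq> y" if "brw_alive (\<lambda>v. \<omega> (p # v)) u" for u
            using 1 p that by (auto simp: avoids_def alive_Cons pos_Cons dest: spec[of _ "p # u"])
          then show ?thesis by (simp add: avoids_def)
        next
          case 2
          then show ?thesis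
            using p extinct_subtree[of \<omega> "[p]"] by (simp add: alive_Cons)
        qed
      qed
      have "Measurable.pred (brw_space \<mu> z)
          (\<lambda>\<omega>. \<forall>p. p \<in> offspring (\<omega> []) \<longrightarrow> ?E (fst p) (\<lambda>v. \<omega> (p # v)))"
        by (intro pred_intros_countable pred_intros_logic measurable_offspring
            measurable_subtree_pred(2)[OF measurable_avoids] measurable_subtree_pred(2)[OF measurable_extinct])
      then show "{\<omega>. \<forall>p\<in>offspring (\<omega> []). ?E (fst p) (\<lambda>v. \<omega> (p # v))} \<in> sets (brw_space \<mu> z)"
        by (simp add: pred_def Ball_def)
    qed
    also have "\<dots> = brw_G \<mu> v z"
      unfolding v_def by (rule prob_all_children[of \<mu> z ?E, OF spec[OF fin] pred_E])
    finally show ?thesis .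
  qed
  have "\<exists>z. brw_qbar \<mu> z < v z"
  proof (rule ccontr)
    assume "\<not> (\<exists>z. brw_qbar \<mu> z < v z)"
    then have eq: "v z = brw_qbar \<mu> z" for z
      using ge[of z] by (meson antisym not_le)
    have "AE \<omega> in brw_space \<mu> z. avoids y z \<omega> \<longrightarrow> extinct \<omega>" for z
    proof -
      have "measure (brw_space \<mu> z) ({\<omega>. ?E z \<omega>} - {\<omega>. extinct \<omega>}) = v z - brw_qbar \<mu> z"
        unfolding v_def brw_qbar_extinct by (rule P.finite_measure_Diff[OF sets_E sets_ext]) auto
      then have "{\<omega>. ?E z \<omega>} - {\<omega>. extinct \<omega>} \<in> null_sets (brw_space \<mu> z)"
        using sets_E[of z] sets_ext[of z] by (auto simp: null_sets_def P.emeasure_eq_measure eq)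
      then show ?thesis
        by (rule AE_I') auto
    qed
    then have "brw_q \<mu> x y \<le> brw_qbar \<mu> x"
      by (rule q_le_qbar_if_avoids_extinct[OF fin])
    with qbar_le_q[of \<mu> x y] neq show False by simp
  qed
  then obtain x0 where x0: "brw_qbar \<mu> x0 < v x0" by blast
  show ?thesis
  proof
    show "x0 \<noteq> y" using x0 vy by auto
    show "brw_tau \<mu> v y < brw_tau \<mu> v x0"
      using x0 vy qbar[of x0] by (simp add: brw_tau_def)
    show "0 \<le> v x" "v x \<le> 1" for x by (simp_all add: v_def)
  qed (use ge sub in auto)
qed

lemma tau_le_Max_if_q_eq_qbar:
  fixes \<mu> :: "'a::countable \<Rightarrow> ('a \<Rightarrow> nat) pmf"
  assumes fin: "\<forall>x. \<forall>f\<in>set_pmf (\<mu> x). fin_supp f"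
    and qbar: "\<And>x. brw_qbar \<mu> x < 1" and eq: "\<And>x y. brw_q \<mu> x y = brw_qbar \<mu> x"
    and A: "finite A" "A \<noteq> {}" and v: "\<And>x. 0 \<le> v x" "\<And>x. v x \<le> 1" "\<And>x. brw_qbar \<mu> x \<le> v x"
    and sub: "\<And>x. x \<notin> A \<Longrightarrow> v x \<le> brw_G \<mu> v x"
  shows "brw_tau \<mu> v x \<le> Max (brw_tau \<mu> v ` A)"
proof -
  define t where "t = Max (brw_tau \<mu> v ` A)"
  have tau: "v x = (1 - brw_tau \<mu> v x) * brw_qbar \<mu> x + brw_tau \<mu> v x" for x
  proof -
    have "brw_tau \<mu> v x * (1 - brw_qbar \<mu> x) = v x - brw_qbar \<mu> x"
      using qbar[of x] by (simp add: brw_tau_def)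
    then show ?thesis by (simp add: algebra_simps)
  qed
  have tau01: "0 \<le> brw_tau \<mu> v x" "brw_tau \<mu> v x \<le> 1" for x
    using qbar[of x] v(2,3)[of x] by (simp_all add: brw_tau_def)
  have "t \<in> brw_tau \<mu> v ` A"
    unfolding t_def using A by (intro Max_in) auto
  then have t: "0 \<le> t" "t \<le> 1" using tau01 by auto
  have mono: "(1 - s) * brw_qbar \<mu> x + s \<le> (1 - t) * brw_qbar \<mu> x + t \<longleftrightarrow> s \<le> t" for s x
  proof -
    have "(1 - t) * brw_qbar \<mu> x + t - ((1 - s) * brw_qbar \<mu> x + s) = (t - s) * (1 - brw_qbar \<mu> x)"
      by (simp add: algebra_simps)
    then show ?thesis
      using qbar[of x] by (smt (verit) mult_nonneg_nonneg mult_pos_pos zero_le_mult_iff)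
  qed
  have bound: "v x \<le> (1 - t) * brw_qbar \<mu> x + t" if "x \<in> A" for x
  proof -
    have "brw_tau \<mu> v x \<le> t" unfolding t_def using A that by simp
    then show ?thesis using mono[of "brw_tau \<mu> v x" x] tau[of x] by simp
  qed
  obtain y where y: "y \<in> A" using A by blast
  have "v x \<le> (1 - t) * measure (brw_space \<mu> x) {\<omega>. \<forall>n. hits_extinct A n x \<omega>} + t"
    using fin v sub t bound by (intro subsolution_le_hits_extinct) auto
  also have "\<dots> \<le> (1 - t) * brw_qbar \<mu> x + t"
    using prob_hits_extinct_le_q[OF fin A(1) ballI[OF qbar] y, where x = x] t(2) by (simp add: eq mult_left_mono)
  finally show ?thesis
    using mono[of "brw_tau \<mu> v x" x] tau[of x] by (simp add: t_def)
qed

theorem mainTheorem4: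
  fixes \<mu> :: "'a::countable \<Rightarrow> ('a \<Rightarrow> nat) pmf"
  assumes "BRW \<mu>" and "brw_irreducible \<mu>" and "\<forall>x. brw_qbar \<mu> x < 1"
  shows "(\<exists>x y. brw_q \<mu> x y \<noteq> brw_qbar \<mu> x) \<longleftrightarrow>
    (\<exists>A v. finite A \<and> A \<noteq> {} \<and> (\<forall>x. 0 \<le> v x \<and> v x \<le> 1) \<and>
       (\<forall>x. brw_qbar \<mu> x \<le> v x) \<and>
       (\<forall>x\<in>- A. brw_G \<mu> v x \<ge> v x) \<and>
       (\<exists>x0\<in>- A. brw_tau \<mu> v x0 > Max (brw_tau \<mu> v ` A)))"
    (is "?L \<longleftrightarrow> ?R")
proof
  have fin: "\<forall>x. \<forall>f\<in>set_pmf (\<mu> x). fin_supp f"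
    using assms(1) by (simp add: BRW_def)
  have qbar: "brw_qbar \<mu> x < 1" for x using assms(3) by blast
  show ?R if ?L
  proof -
    from that obtain x y where "brw_q \<mu> x y \<noteq> brw_qbar \<mu> x" by blast
    then obtain v x0 where "\<And>x. 0 \<le> v x" "\<And>x. v x \<le> 1" "\<And>x. brw_qbar \<mu> x \<le> v x"
      "\<And>x. x \<noteq> y \<Longrightarrow> v x \<le> brw_G \<mu> v x" "x0 \<noteq> y" "brw_tau \<mu> v y < brw_tau \<mu> v x0"
      using separating_function_if_q_neq_qbar[OF fin qbar] by blast
    then show ?R
      by (intro exI[of _ "{y}"] exI[of _ v]) auto
  qed
  show ?L if ?R
  proof (rule ccontr)
    assume "\<not> ?L"
    then have eq: "\<And>x y. brw_q \<mu> x y = brw_qbar \<mu> x" by blast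
    from that obtain A v where *: "finite A" "A \<noteq> {}" "\<forall>x. 0 \<le> v x \<and> v x \<le> 1"
      "\<forall>x. brw_qbar \<mu> x \<le> v x" "\<forall>x\<in>- A. brw_G \<mu> v x \<ge> v x"
      and "\<exists>x0\<in>- A. brw_tau \<mu> v x0 > Max (brw_tau \<mu> v ` A)"
      by blast
    then obtain x0 where x0: "brw_tau \<mu> v x0 > Max (brw_tau \<mu> v ` A)" by blast
    have "brw_tau \<mu> v x0 \<le> Max (brw_tau \<mu> v ` A)"
      by (rule tau_le_Max_if_q_eq_qbar[OF fin qbar eq *(1,2)]) (use *(3-5) in auto)
    with x0 show False by simp
  qed
qed

end
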